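(* Let $X$ be a complex Banach space, let $A$ be a closed linear operator on $X$ with domain $\mathcal{D}(A)\subset X$ and range $\mathrm{ran}\,A$, and let $V=(\mathcal{D}(A),\|\cdot\|_A)$ be its graph space. Let $g\in C^\infty(A)\cap \mathrm{ran}\,A$. Suppose that the closed Krylov subspace $\overline{\mathcal{K}(A,g)}^{V}$ (closure in $V$) has a topological complement $G\subset V$ in $V$, and let $\mathcal{I}(A,g)=\overline{\mathcal{K}(A,g)}\cap A(G)$ be the corresponding Krylov intersection (where $\overline{\mathcal{K}(A,g)}$ is the closure in $X$). (i) If $\mathcal{I}(A,g)=\{0\}$, then there exists a solution $f\in\mathcal{D}(A)$ to $Af=g$ such that $f\in\overline{\mathcal{K}(A,g)}^{V}$. (ii) If in addition $0\in\rho(A)$, then the solution $f$ to $Af=g$ satisfies $f\in\overline{\mathcal{K}(A,g)}^{V}$ if and only if $\mathcal{I}(A,g)=\{0\}$.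
   Context: $C^\infty(A)=\bigcap_{k\ge 0}\mathcal{D}(A^k)$ is the set of $A$-smooth vectors. For $g\in C^\infty(A)$ the Krylov subspace is $\mathcal{K}(A,g)=\mathrm{span}\{A^kg \mid k\in\mathbb{N}_0\}$. The graph norm is $\|x\|_A=\|x\|_X+\|Ax\|_X$ for $x\in\mathcal{D}(A)$; since $A$ is closed, $V=(\mathcal{D}(A),\|\cdot\|_A)$ is a Banach space. $\overline{\mathcal{K}(A,g)}$ denotes closure in $X$ and $\overline{\mathcal{K}(A,g)}^{V}$ closure in $V$. A topological complement of a closed subspace $E$ of a Banach space $Y$ is a closed subspace $G\subset Y$ with $E\cap G=\{0\}$ and $E+G=Y$. Given a topological complement $G$ of $\overline{\mathcal{K}(A,g)}^{V}$ in $V$, the Krylov intersection is $\mathcal{I}(A,g):=\overline{\mathcal{K}(A,g)}\cap A(G)$. $\rho(A)$ is the resolvent set of $A$. *)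

theory Defs
  imports "HOL-Analysis.Analysis"
begin

section \<open>Complex Banach spaces\<close>

text \<open>The distribution only has real Banach spaces. A complex one is a real Banach space with a
  compatible complex scalar multiplication for which the norm is absolutely homogeneous.\<close>

class complex_banach = banach +
  fixes scaleC :: "complex \<Rightarrow> 'a \<Rightarrow> 'a"  (infixr \<open>*\<^sub>C\<close> 75)
  assumes scaleC_add_right: "c *\<^sub>C (x + y) = c *\<^sub>C x + c *\<^sub>C y"
    and scaleC_add_left: "(c + d) *\<^sub>C x = c *\<^sub>C x + d *\<^sub>C x"
    and scaleC_scaleC: "c *\<^sub>C d *\<^sub>C x = (c * d) *\<^sub>C x"
    and scaleR_scaleC: "r *\<^sub>R x = complex_of_real r *\<^sub>C x"
    and norm_scaleC: "norm (c *\<^sub>C x) = cmod c * norm x"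

instantiation complex :: complex_banach
begin

definition scaleC_complex :: "complex \<Rightarrow> complex \<Rightarrow> complex"
  where "scaleC_complex c x = c * x"

instance
  by standard (simp_all add: scaleC_complex_def algebra_simps norm_mult scaleR_conv_of_real)

end

lemma vector_space_scaleC: "vector_space (scaleC :: complex \<Rightarrow> 'a::complex_banach \<Rightarrow> 'a)"
proof
  fix x :: 'a
  have "1 *\<^sub>C x = 1 *\<^sub>R x" by (simp only: scaleR_scaleC of_real_1)
  then show "1 *\<^sub>C x = x" by simp
qed (simp_all add: scaleC_add_right scaleC_add_left scaleC_scaleC)

global_interpretation complex_vector: vector_space "scaleC :: complex \<Rightarrow> 'a::complex_banach \<Rightarrow> 'a"
  by (rule vector_space_scaleC)

section \<open>Unbounded operators\<close>

text \<open>An operator is given by its domain \<open>D\<close> and a function \<open>A\<close> whose values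
  outside \<open>D\<close> are irrelevant. The domain need not be dense.\<close>

definition linear_operator :: "'a::complex_banach set \<Rightarrow> ('a \<Rightarrow> 'a) \<Rightarrow> bool" where
  "linear_operator D A \<longleftrightarrow> complex_vector.subspace D \<and>
     (\<forall>x\<in>D. \<forall>y\<in>D. A (x + y) = A x + A y) \<and> (\<forall>c. \<forall>x\<in>D. A (c *\<^sub>C x) = c *\<^sub>C A x)"

definition closed_operator :: "'a::complex_banach set \<Rightarrow> ('a \<Rightarrow> 'a) \<Rightarrow> bool" where
  "closed_operator D A \<longleftrightarrow> linear_operator D A \<and> closed ((\<lambda>x. (x, A x)) ` D)"

primrec dom_power :: "'a::complex_banach set \<Rightarrow> ('a \<Rightarrow> 'a) \<Rightarrow> nat \<Rightarrow> 'a set" where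
  "dom_power D A 0 = UNIV"
| "dom_power D A (Suc k) = {x \<in> dom_power D A k. (A ^^ k) x \<in> D}"

definition smooth_vectors :: "'a::complex_banach set \<Rightarrow> ('a \<Rightarrow> 'a) \<Rightarrow> 'a set" where
  "smooth_vectors D A = (\<Inter>k. dom_power D A k)"

definition resolvent_set :: "'a::complex_banach set \<Rightarrow> ('a \<Rightarrow> 'a) \<Rightarrow> complex set" where
  "resolvent_set D A = {z. bij_betw (\<lambda>x. A x - z *\<^sub>C x) D UNIV \<and>
     bounded_linear (inv_into D (\<lambda>x. A x - z *\<^sub>C x))}"

section \<open>The graph space\<close>

definition graph_norm :: "('a::complex_banach \<Rightarrow> 'a) \<Rightarrow> 'a \<Rightarrow> real" where
  "graph_norm A x = norm x + norm (A x)"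

text \<open>The locale \<^locale>\<open>Metric_space\<close> demands symmetry and nonnegativity of the distance
  on the whole type, not just on the carrier, hence the value 0 off \<open>D\<close>.\<close>

definition graph_dist :: "'a::complex_banach set \<Rightarrow> ('a \<Rightarrow> 'a) \<Rightarrow> 'a \<Rightarrow> 'a \<Rightarrow> real" where
  "graph_dist D A x y = (if x \<in> D \<and> y \<in> D then graph_norm A (x - y) else 0)"

definition graph_topology :: "'a::complex_banach set \<Rightarrow> ('a \<Rightarrow> 'a) \<Rightarrow> 'a topology" where
  "graph_topology D A = Metric_space.mtopology D (graph_dist D A)"

lemma Metric_space_graph_dist:
  assumes "linear_operator D A"
  shows "Metric_space D (graph_dist D A)"
proof -
  have sub: "x - y \<in> D" if "x \<in> D" "y \<in> D" for x y
    using assms that complex_vector.subspace_diff unfolding linear_operator_def by blast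
  have add: "A (x + y) = A x + A y" if "x \<in> D" "y \<in> D" for x y
    using assms that unfolding linear_operator_def by blast
  have diff: "A (x - y) = A x - A y" if "x \<in> D" "y \<in> D" for x y
    using add[OF sub[OF that] that(2)] by simp
  show ?thesis
  proof
    fix x y z assume D: "x \<in> D" "y \<in> D" "z \<in> D"
    have "norm (x - z) \<le> norm (x - y) + norm (y - z)"
      by (rule norm_diff_triangle_le[OF order_refl order_refl])
    moreover have "norm (A x - A z) \<le> norm (A x - A y) + norm (A y - A z)"
      by (rule norm_diff_triangle_le[OF order_refl order_refl])
    ultimately show "graph_dist D A x z \<le> graph_dist D A x y + graph_dist D A y z"
      using D by (simp add: graph_dist_def graph_norm_def diff)
  next
    fix x y assume D: "x \<in> D" "y \<in> D"
    then show "graph_dist D A x y = 0 \<longleftrightarrow> x = y"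
      by (auto simp: graph_dist_def graph_norm_def diff add_nonneg_eq_0_iff)
  qed (auto simp: graph_dist_def graph_norm_def diff norm_minus_commute)
qed

definition topological_complement ::
    "'a::complex_banach set \<Rightarrow> ('a \<Rightarrow> 'a) \<Rightarrow> 'a set \<Rightarrow> 'a set \<Rightarrow> bool" where
  "topological_complement D A E G \<longleftrightarrow>
     complex_vector.subspace G \<and> closedin (graph_topology D A) G \<and>
     E \<inter> G = {0} \<and> {x + y | x y. x \<in> E \<and> y \<in> G} = D"

section \<open>Krylov subspaces\<close>

definition krylov :: "('a::complex_banach \<Rightarrow> 'a) \<Rightarrow> 'a \<Rightarrow> 'a set" where
  "krylov A g = complex_vector.span (range (\<lambda>k. (A ^^ k) g))"

definition krylov_closure_V :: "'a::complex_banach set \<Rightarrow> ('a \<Rightarrow> 'a) \<Rightarrow> 'a \<Rightarrow> 'a set" where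
  "krylov_closure_V D A g = graph_topology D A closure_of krylov A g"

definition krylov_intersection :: "('a::complex_banach \<Rightarrow> 'a) \<Rightarrow> 'a \<Rightarrow> 'a set \<Rightarrow> 'a set" where
  "krylov_intersection A g G = closure (krylov A g) \<inter> A ` G"

end

theory Submission
  imports Defs
begin

text \<open>Write \<open>K\<close> for the Krylov space, \<open>K'\<close> for its closure in \<open>X\<close> and \<open>E\<close> for its closure in the
  graph space. The point is that the Krylov intersection is the only obstruction to solving
  \<open>A f = g\<close> inside \<open>E\<close>.

  Since \<open>A\<close> maps \<open>K\<close> into itself and is continuous for the graph norm, \<open>A\<close> maps \<open>E\<close> into \<open>K'\<close>.
  Decompose any solution as \<open>f = e + h\<close> with \<open>e \<in> E\<close> and \<open>h \<in> G\<close>. Then \<open>A h = g - A e\<close> lies both in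
  \<open>K'\<close> and in \<open>A G\<close>; if the intersection is trivial, then \<open>A h = 0\<close> and \<open>e\<close> is already a solution.

  Let now \<open>A\<close> have a bounded inverse. By uniqueness, a trivial intersection forces the solution
  \<open>f\<close> into \<open>E\<close>. Conversely, if \<open>f \<in> E\<close>, then \<open>A\<inverse> K\<close> is spanned by \<open>f, g, A g, \<dots>\<close> and hence
  contained in \<open>E\<close>. Continuity of \<open>A\<inverse>\<close>, seen as a map from \<open>X\<close> into the graph space, extends this
  to \<open>A\<inverse> K' \<subseteq> E\<close>. So a vector \<open>A h\<close> of the Krylov intersection, with \<open>h \<in> G\<close>, has
  \<open>h \<in> E \<inter> G = {0}\<close>.\<close>

lemma linear_operatorD:
  assumes "linear_operator D A"
  shows "complex_vector.subspace D"
    and "\<And>x y. \<lbrakk>x \<in> D; y \<in> D\<rbrakk> \<Longrightarrow> A (x + y) = A x + A y"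
    and "\<And>c x. x \<in> D \<Longrightarrow> A (c *\<^sub>C x) = c *\<^sub>C A x"
    and "A 0 = 0"
    and "\<And>x y. \<lbrakk>x \<in> D; y \<in> D\<rbrakk> \<Longrightarrow> A (x - y) = A x - A y"
proof -
  show sub: "complex_vector.subspace D"
    and add: "\<And>x y. \<lbrakk>x \<in> D; y \<in> D\<rbrakk> \<Longrightarrow> A (x + y) = A x + A y"
    and "\<And>c x. x \<in> D \<Longrightarrow> A (c *\<^sub>C x) = c *\<^sub>C A x"
    using assms unfolding linear_operator_def by auto
  show "A 0 = 0"
    using add[of 0 0] complex_vector.subspace_0[OF sub] by simp
  show "A (x - y) = A x - A y" if "x \<in> D" "y \<in> D" for x y
    using add[of "x - y" y] complex_vector.subspace_diff[OF sub that] that by simp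
qed

lemma bounded_linear_scaleC: "bounded_linear (scaleC c :: 'a::complex_banach \<Rightarrow> 'a)"
proof (rule bounded_linear_intro[where K = "cmod c"])
  show "c *\<^sub>C r *\<^sub>R x = r *\<^sub>R c *\<^sub>C x" for r and x :: 'a
    by (simp add: scaleR_scaleC scaleC_scaleC mult.commute)
qed (simp_all add: scaleC_add_right norm_scaleC mult.commute)

text \<open>The map \<open>x \<mapsto> (x, A x)\<close> identifies the graph space with a subspace of \<open>X \<times> X\<close>, because the
  graph norm is equivalent to the product norm. All closures in the graph space can thus be handled
  as ordinary closures in \<open>X \<times> X\<close>.\<close>

lemma graph_closure_of_eq:
  assumes A: "linear_operator D A" and S: "S \<subseteq> D"
  shows "graph_topology D A closure_of S = {x \<in> D. (x, A x) \<in> closure ((\<lambda>x. (x, A x)) ` S)}"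
proof -
  interpret Metric_space D "graph_dist D A"
    by (rule Metric_space_graph_dist[OF A])
  have d: "graph_dist D A x y = norm (x - y) + norm (A x - A y)" if "x \<in> D" "y \<in> D" for x y
    using that linear_operatorD(5)[OF A] by (simp add: graph_dist_def graph_norm_def)
  have "(\<forall>r>0. \<exists>y\<in>S. y \<in> mball x r) \<longleftrightarrow> (x, A x) \<in> closure ((\<lambda>x. (x, A x)) ` S)"
    if x: "x \<in> D" for x
  proof
    assume L: "\<forall>r>0. \<exists>y\<in>S. y \<in> mball x r"
    show "(x, A x) \<in> closure ((\<lambda>x. (x, A x)) ` S)"
      unfolding closure_approachable
    proof (intro allI impI)
      fix e :: real assume "e > 0"
      then obtain y where y: "y \<in> S" "y \<in> mball x e" using L by blast
      then have "norm (x - y) + norm (A x - A y) < e"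
        using x d by auto
      then have "dist (x, A x) (y, A y) < e"
        using norm_Pair_le[of "x - y" "A x - A y"] by (simp add: dist_norm)
      then have "dist (y, A y) (x, A x) < e"
        by (subst dist_commute)
      then show "\<exists>p\<in>(\<lambda>x. (x, A x)) ` S. dist p (x, A x) < e"
        using y by blast
    qed
  next
    assume R: "(x, A x) \<in> closure ((\<lambda>x. (x, A x)) ` S)"
    show "\<forall>r>0. \<exists>y\<in>S. y \<in> mball x r"
    proof (intro allI impI)
      fix r :: real assume "r > 0"
      then obtain y where y: "y \<in> S" "dist (y, A y) (x, A x) < r / 2"
        using R unfolding closure_approachable by (fastforce dest: spec[of _ "r / 2"])
      then have "dist (x, A x) (y, A y) < r / 2"
        by (subst dist_commute)
      then have "norm (x - y, A x - A y) < r / 2"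
        by (simp add: dist_norm)
      then have "norm (x - y) + norm (A x - A y) < r"
        using norm_fst_le[of "x - y" "A x - A y"] norm_snd_le[of "A x - A y" "x - y"] by linarith
      moreover have "y \<in> D" using y(1) S by blast
      ultimately have "y \<in> mball x r"
        using x d[of x y] by simp
      then show "\<exists>y\<in>S. y \<in> mball x r"
        using y(1) by blast
    qed
  qed
  then show ?thesis
    unfolding graph_topology_def metric_closure_of by auto
qed

lemma subspace_graph_closure_of:
  assumes A: "linear_operator D A" and K: "complex_vector.subspace K" "K \<subseteq> D"
  shows "complex_vector.subspace (graph_topology D A closure_of K)"
proof -
  note D = linear_operatorD[OF A]
  let ?\<Gamma> = "(\<lambda>x. (x, A x)) ` K"
  note eq = graph_closure_of_eq[OF A K(2)]
  have "x + y \<in> graph_topology D A closure_of K"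
    if "x \<in> graph_topology D A closure_of K" "y \<in> graph_topology D A closure_of K" for x y
  proof -
    from that have x: "x \<in> D" "(x, A x) \<in> closure ?\<Gamma>" and y: "y \<in> D" "(y, A y) \<in> closure ?\<Gamma>"
      unfolding eq by auto
    obtain p q where p: "\<forall>n. p n \<in> ?\<Gamma>" "p \<longlonglongrightarrow> (x, A x)" and q: "\<forall>n. q n \<in> ?\<Gamma>" "q \<longlonglongrightarrow> (y, A y)"
      using x(2) y(2) unfolding closure_sequential by blast
    have "p n + q n \<in> ?\<Gamma>" for n
    proof -
      obtain a b where ab: "a \<in> K" "b \<in> K" "p n = (a, A a)" "q n = (b, A b)"
        using p(1) q(1) by blast
      then have "p n + q n = (a + b, A (a + b))"
        using D(2)[of a b] subsetD[OF K(2)] by simp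
      then show ?thesis
        using complex_vector.subspace_add[OF K(1) ab(1,2)] by blast
    qed
    moreover have "(\<lambda>n. p n + q n) \<longlonglongrightarrow> (x, A x) + (y, A y)"
      by (intro tendsto_add p q)
    ultimately have "(x, A x) + (y, A y) \<in> closure ?\<Gamma>"
      unfolding closure_sequential by (intro exI[of _ "\<lambda>n. p n + q n"]) blast
    then show ?thesis
      unfolding eq using x y D(2) complex_vector.subspace_add[OF D(1)] by auto
  qed
  moreover have "c *\<^sub>C x \<in> graph_topology D A closure_of K"
    if "x \<in> graph_topology D A closure_of K" for c x
  proof -
    from that have x: "x \<in> D" "(x, A x) \<in> closure ?\<Gamma>"
      unfolding eq by auto
    obtain p where p: "\<forall>n. p n \<in> ?\<Gamma>" "p \<longlonglongrightarrow> (x, A x)"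
      using x(2) unfolding closure_sequential by blast
    have "(c *\<^sub>C fst (p n), c *\<^sub>C snd (p n)) \<in> ?\<Gamma>" for n
    proof -
      obtain a where a: "a \<in> K" "p n = (a, A a)"
        using p(1) by blast
      then have "(c *\<^sub>C fst (p n), c *\<^sub>C snd (p n)) = (c *\<^sub>C a, A (c *\<^sub>C a))"
        using D(3)[of a c] subsetD[OF K(2)] by simp
      then show ?thesis
        using complex_vector.subspace_scale[OF K(1) a(1)] by blast
    qed
    moreover have "(\<lambda>n. (c *\<^sub>C fst (p n), c *\<^sub>C snd (p n))) \<longlonglongrightarrow> (c *\<^sub>C x, c *\<^sub>C A x)"
      using tendsto_fst[OF p(2)] tendsto_snd[OF p(2)]
      by (intro tendsto_Pair bounded_linear.tendsto[OF bounded_linear_scaleC]) simp_all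
    ultimately have "(c *\<^sub>C x, c *\<^sub>C A x) \<in> closure ?\<Gamma>"
      unfolding closure_sequential
      by (intro exI[of _ "\<lambda>n. (c *\<^sub>C fst (p n), c *\<^sub>C snd (p n))"]) blast
    then show ?thesis
      unfolding eq using x D(3) complex_vector.subspace_scale[OF D(1)] by auto
  qed
  moreover have "0 \<in> graph_topology D A closure_of K"
  proof -
    have "(0, A 0) \<in> ?\<Gamma>"
      using complex_vector.subspace_0[OF K(1)] by blast
    then show ?thesis
      unfolding eq using complex_vector.subspace_0[OF D(1)]
        subsetD[OF closure_subset[of ?\<Gamma>]] by simp
  qed
  ultimately show ?thesis
    by (intro complex_vector.subspaceI)
qed

lemma graph_closure_of_superset:
  assumes "linear_operator D A" "S \<subseteq> D"
  shows "S \<subseteq> graph_topology D A closure_of S"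
  unfolding graph_closure_of_eq[OF assms] using assms(2) closure_subset by fast

text \<open>On the graph, \<open>A\<close> is the second projection of \<open>X \<times> X\<close>, which is continuous.\<close>

lemma image_graph_closure_of_subset:
  assumes "linear_operator D A" "S \<subseteq> D"
  shows "A ` (graph_topology D A closure_of S) \<subseteq> closure (A ` S)"
proof -
  have "snd ` closure ((\<lambda>x. (x, A x)) ` S) \<subseteq> closure (snd ` (\<lambda>x. (x, A x)) ` S)"
    by (rule image_closure_subset) (auto intro: continuous_intros closure_subset[THEN subsetD])
  then have "A x \<in> closure (A ` S)" if "(x, A x) \<in> closure ((\<lambda>x. (x, A x)) ` S)" for x
    using that by (force simp: image_image)
  then show ?thesis
    unfolding graph_closure_of_eq[OF assms] by blast
qed

text \<open>A bounded inverse \<open>T\<close> of \<open>A\<close> is a homeomorphism of \<open>X\<close> onto the graph space, since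
  \<open>y \<mapsto> (T y, A (T y)) = (T y, y)\<close> is continuous. Hence \<open>A\<close> maps sets that are closed in the graph
  norm to closed sets.\<close>

lemma closed_image_graph_closure_of:
  assumes A: "linear_operator D A" and S: "S \<subseteq> D" and res: "0 \<in> resolvent_set D A"
  shows "closed (A ` (graph_topology D A closure_of S))"
proof -
  define T where "T = inv_into D A"
  have bij: "bij_betw A D UNIV" and T: "bounded_linear T"
    using res by (simp_all add: resolvent_set_def T_def)
  have TD: "T y \<in> D" and AT: "A (T y) = y" for y
    using bij unfolding T_def bij_betw_def by (simp_all add: inv_into_into f_inv_into_f)
  have TA: "T (A x) = x" if "x \<in> D" for x
    using bij that unfolding T_def by (simp add: bij_betw_inv_into_left)
  have "A ` (graph_topology D A closure_of S) =
      (\<lambda>y. (T y, y)) -` closure ((\<lambda>x. (x, A x)) ` S)"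
  proof (intro set_eqI iffI)
    fix y assume "y \<in> A ` (graph_topology D A closure_of S)"
    then show "y \<in> (\<lambda>y. (T y, y)) -` closure ((\<lambda>x. (x, A x)) ` S)"
      unfolding graph_closure_of_eq[OF A S] by (auto simp: TA)
  next
    fix y assume "y \<in> (\<lambda>y. (T y, y)) -` closure ((\<lambda>x. (x, A x)) ` S)"
    then have "T y \<in> graph_topology D A closure_of S"
      unfolding graph_closure_of_eq[OF A S] by (simp add: TD AT)
    then show "y \<in> A ` (graph_topology D A closure_of S)"
      using image_eqI[of y A "T y"] AT by simp
  qed
  moreover have "closed ((\<lambda>y. (T y, y)) -` closure ((\<lambda>x. (x, A x)) ` S))"
    by (intro continuous_closed_vimage closed_closure continuous_intros
        bounded_linear.continuous[OF T])
  ultimately show ?thesis by simp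
qed

lemma subspace_operator_image:
  assumes A: "linear_operator D A" and E: "complex_vector.subspace E" "E \<subseteq> D"
  shows "complex_vector.subspace (A ` E)"
proof (rule complex_vector.subspaceI)
  note D = linear_operatorD[OF A]
  show "0 \<in> A ` E"
    using image_eqI[of 0 A 0 E] D(4) complex_vector.subspace_0[OF E(1)] by simp
  show "x + y \<in> A ` E" if "x \<in> A ` E" "y \<in> A ` E" for x y
  proof -
    obtain a b where ab: "a \<in> E" "b \<in> E" "x = A a" "y = A b" using \<open>x \<in> A ` E\<close> \<open>y \<in> A ` E\<close> by blast
    then have "x + y = A (a + b)" using D(2)[of a b] subsetD[OF E(2)] by simp
    then show ?thesis using complex_vector.subspace_add[OF E(1) ab(1,2)] by blast
  qed
  show "c *\<^sub>C x \<in> A ` E" if "x \<in> A ` E" for c x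
  proof -
    obtain a where a: "a \<in> E" "x = A a" using \<open>x \<in> A ` E\<close> by blast
    then have "c *\<^sub>C x = A (c *\<^sub>C a)" using D(3)[of a c] subsetD[OF E(2)] by simp
    then show ?thesis using complex_vector.subspace_scale[OF E(1) a(1)] by blast
  qed
qed

lemma subspace_operator_preimage:
  assumes A: "linear_operator D A" and W: "complex_vector.subspace W"
  shows "complex_vector.subspace {x \<in> D. A x \<in> W}"
  using linear_operatorD[OF A] W unfolding complex_vector.subspace_def by auto

lemma subspace_krylov: "complex_vector.subspace (krylov A g)"
  unfolding krylov_def by (rule complex_vector.subspace_span)

lemma power_in_krylov: "(A ^^ k) g \<in> krylov A g"
  unfolding krylov_def by (intro complex_vector.span_base rangeI)

lemma power_smooth_in_domain:
  assumes "g \<in> smooth_vectors D A"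
  shows "(A ^^ k) g \<in> D"
proof -
  have "g \<in> dom_power D A (Suc k)"
    using assms unfolding smooth_vectors_def by blast
  then show ?thesis by simp
qed

lemma krylov_invariant:
  assumes A: "linear_operator D A" and g: "g \<in> smooth_vectors D A"
  shows "krylov A g \<subseteq> {x \<in> D. A x \<in> krylov A g}"
proof -
  have "range (\<lambda>k. (A ^^ k) g) \<subseteq> {x \<in> D. A x \<in> krylov A g}"
    using power_smooth_in_domain[OF g] power_in_krylov[where k = "Suc k" for k, simplified] by blast
  then have "complex_vector.span (range (\<lambda>k. (A ^^ k) g)) \<subseteq> {x \<in> D. A x \<in> krylov A g}"
    by (rule complex_vector.span_minimal[OF _ subspace_operator_preimage[OF A subspace_krylov]])
  then show ?thesis by (simp add: krylov_def)
qed

text \<open>The generators \<open>g, A g, A\<^sup>2 g, \<dots>\<close> of the Krylov space are the images of \<open>f, g, A g, \<dots>\<close>, so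
  once \<open>f\<close> is added, the whole Krylov space has preimages in \<open>E\<close>.\<close>

lemma krylov_subset_image:
  assumes A: "linear_operator D A" and E: "complex_vector.subspace E" "krylov A g \<subseteq> E" "E \<subseteq> D"
    and f: "f \<in> E" "A f = g"
  shows "krylov A g \<subseteq> A ` E"
proof -
  have "(A ^^ k) g \<in> A ` E" for k
  proof (cases k)
    case 0
    then show ?thesis using f by auto
  next
    case (Suc m)
    then show ?thesis using power_in_krylov E(2) by fastforce
  qed
  then have "complex_vector.span (range (\<lambda>k. (A ^^ k) g)) \<subseteq> A ` E"
    by (intro complex_vector.span_minimal subspace_operator_image[OF A E(1,3)]) auto
  then show ?thesis by (simp add: krylov_def)
qed

theorem theorem2p6:
  fixes D :: "'a::complex_banach set" and A :: "'a \<Rightarrow> 'a" and g :: 'a and G :: "'a set"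
  assumes "closed_operator D A"
    and "g \<in> smooth_vectors D A \<inter> A ` D"
    and "topological_complement D A (krylov_closure_V D A g) G"
  shows "(krylov_intersection A g G = {0} \<longrightarrow>
           (\<exists>f\<in>D. A f = g \<and> f \<in> krylov_closure_V D A g)) \<and>
         (0 \<in> resolvent_set D A \<longrightarrow>
           (\<forall>f\<in>D. A f = g \<longrightarrow>
              (f \<in> krylov_closure_V D A g \<longleftrightarrow> krylov_intersection A g G = {0})))"
proof -
  define K E where "K = krylov A g" and "E = krylov_closure_V D A g"
  have A: "linear_operator D A" and g: "g \<in> smooth_vectors D A" "g \<in> A ` D"
    using assms(1,2) by (auto simp: closed_operator_def)
  note D = linear_operatorD[OF A]
  have G: "complex_vector.subspace G" "E \<inter> G = {0}" "{x + y | x y. x \<in> E \<and> y \<in> G} = D"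
    using assms(3) by (auto simp: topological_complement_def E_def)
  have K: "complex_vector.subspace K" "K \<subseteq> D" "A ` K \<subseteq> K"
    using subspace_krylov krylov_invariant[OF A g(1)] by (auto simp: K_def)
  have E_eq: "E = graph_topology D A closure_of K"
    by (simp add: E_def K_def krylov_closure_V_def)
  have E: "complex_vector.subspace E" "K \<subseteq> E" "E \<subseteq> D"
    unfolding E_eq using subspace_graph_closure_of[OF A K(1,2)] graph_closure_of_superset[OF A K(2)]
      graph_closure_of_eq[OF A K(2)] by auto
  have AE: "A ` E \<subseteq> closure K"
    using image_graph_closure_of_subset[OF A K(2)] closure_mono[OF K(3)] by (simp add: E_eq)
  have GD: "G \<subseteq> D"
    using complex_vector.subspace_0[OF E(1)] G(3) by force
  have gK: "g \<in> K"
    using power_in_krylov[of 0 A g] by (simp add: K_def)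
  have solvable: "\<exists>f\<in>E. A f = g" if I: "krylov_intersection A g G = {0}"
  proof -
    obtain f where f: "f \<in> D" "A f = g" using g(2) by blast
    obtain e h where eh: "e \<in> E" "h \<in> G" "f = e + h" using G(3) f(1) by blast
    have Ah: "A h = g - A e"
      using f eh D(2) E(3) GD by fastforce
    \<comment> \<open>The continuous map \<open>y \<mapsto> g - y\<close> preserves \<open>K\<close>, because \<open>g \<in> K\<close>, hence also its closure.\<close>
    have "(\<lambda>y. g - y) ` closure K \<subseteq> closure K"
    proof (rule image_closure_subset)
      show "(\<lambda>y. g - y) ` K \<subseteq> closure K"
        using complex_vector.subspace_diff[OF K(1) gK] closure_subset by blast
    qed (auto intro: continuous_intros)
    then have "A h \<in> closure K"
      unfolding Ah using AE eh(1) by blast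
    then have "A h = 0"
      using I eh(2) by (auto simp: krylov_intersection_def K_def)
    then show ?thesis using Ah eh(1) by auto
  qed
  have trivial: "krylov_intersection A g G = {0}"
    if res: "0 \<in> resolvent_set D A" and f: "f \<in> E" "A f = g" for f
  proof -
    have inj: "inj_on A D"
      using res by (auto simp: resolvent_set_def bij_betw_def)
    have "K \<subseteq> A ` E"
      using krylov_subset_image[OF A E(1) _ E(3) f] E(2) by (simp add: K_def)
    then have KE: "closure K \<subseteq> A ` E"
      using closed_image_graph_closure_of[OF A K(2) res] by (simp add: E_eq closure_minimal)
    have "A ` E \<inter> A ` G = {0}"
      using inj_on_image_Int[OF inj E(3) GD] G(2) D(4) by simp
    moreover have "0 \<in> closure K"
      using complex_vector.subspace_0[OF K(1)] closure_subset by blast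
    ultimately show ?thesis
      using KE unfolding krylov_intersection_def K_def[symmetric] by auto
  qed
  have "f \<in> E \<longleftrightarrow> krylov_intersection A g G = {0}"
    if res: "0 \<in> resolvent_set D A" and f: "f \<in> D" "A f = g" for f
  proof
    assume "krylov_intersection A g G = {0}"
    then obtain e where "e \<in> E" "A e = g" using solvable by blast
    moreover have "inj_on A D"
      using res by (auto simp: resolvent_set_def bij_betw_def)
    ultimately have "e = f"
      using f E(3) by (auto dest: inj_onD)
    with \<open>e \<in> E\<close> show "f \<in> E" by simp
  qed (use trivial res f in blast)
  moreover have "\<exists>f\<in>D. A f = g \<and> f \<in> E" if "krylov_intersection A g G = {0}"
    using solvable[OF that] E(3) by auto
  ultimately show ?thesis
    unfolding E_def by simp
qed

end
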